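(* Let $(E,\mathcal T)$ be a real $L^0$-pre-barreled module such that $E$ has the countable concatenation property. Then a proper lower semicontinuous $L^0$-convex function $f:E\to\bar L^0(\mathcal F)$ is continuous on $\mathrm{Int}(\mathrm{dom}(f))$, the interior of $\mathrm{dom}(f)$; that is, $f$ is continuous from $(\mathrm{Int}(\mathrm{dom}(f)),\mathcal T)$ to $(L^0(\mathcal F),\mathcal T_c)$.
   Context: $(\Omega,\mathcal F,P)$ is a probability space. $L^0(\mathcal F)$ is the algebra of (a.s.-equality) equivalence classes of real $\mathcal F$-measurable random variables with the a.s. order; $L^0_+(\mathcal F)$ and $L^0_{++}(\mathcal F)$ are its elements that are $\ge0$, respectively $>0$, a.s. $\bar L^0(\mathcal F)$ is the complete lattice of classes of $[-\infty,\infty]$-valued $\mathcal F$-measurable functions. $\tilde I_A$ is the class of the indicator of $A\in\mathcal F$. Conventions: $0\cdot(\pm\infty)=0$, $+\infty\pm(\pm\infty)=+\infty$. $\mathcal T_c$ on $L^0(\mathcal F)$: $G$ is open iff for each $x\in G$ there is $\varepsilon\in L^0_{++}(\mathcal F)$ with $\{y:|y-x|\le\varepsilon\}\subset G$; this makes $L^0(\mathcal F)$ a topological ring. Standing assumption on all $L^0(\mathcal F)$-modules $E$: if $x,y\in E$ and $\tilde I_{A_n}x=\tilde I_{A_n}y$ for all $n$ for some countable partition $\{A_n\}$ of $\Omega$ into sets of $\mathcal F$, then $x=y$. In an $L^0(\mathcal F)$-module $E$: a set $B$ is $L^0$-balanced if $\eta B\subset B$ for all $\eta\in L^0(\mathcal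 F)$ with $|\eta|\le1$; $L^0$-convex if $\xi x+(1-\xi)y\in B$ for $x,y\in B$, $\xi\in L^0_+(\mathcal F)$, $0\le\xi\le1$; $L^0$-absorbent if for every $x\in E$ there is $\xi\in L^0_{++}(\mathcal F)$ with $\eta x\in B$ for all $\eta\in L^0(\mathcal F)$, $|\eta|\le\xi$. A (real) locally $L^0$-convex module is a pair $(E,\mathcal T)$ where $E$ is an $L^0(\mathcal F)$-module and $\mathcal T$ a topology on $E$ making addition $E\times E\to E$ and module multiplication $(L^0(\mathcal F),\mathcal T_c)\times E\to E$ jointly continuous and having a local base at $\theta$ (the null element) of $L^0$-balanced, $L^0$-absorbent, $L^0$-convex sets. An $L^0$-barrel is an $L^0$-balanced, $L^0$-absorbent, $L^0$-convex and closed set. A set $G\subset E$ (possibly $G=E$) has the countable concatenation property if for every sequence $\{x_n\}$ in $G$ and countable partition $\{A_n\}$ of $\Omega$ into sets of $\mathcal F$ there is $x\in G$ with $\tilde I_{A_n}x=\tilde I_{A_n}x_n$ for all $n$. A locally $L^0$-convex module is an $L^0$-pre-barreled module if every $L^0$-barrel with the countable concatenation property is a neighborhood of $\theta$. For $f:E\to\bar L^0(\mathcal F)$: $\mathrm{dom}(f)=\{x\in E:|f(x)|<+\infty\text{ a.s.}\}$; $f$ is proper if $\mathrm{dom}(f)\ne\emptyset$ and $f(x)>-\infty$ a.s. for all $x$; $f$ is $L^0$-convex if $f(\xi x+(1-\xi)y)\le\xi f(x)+(1-\xi)f(y)$ for $x,y\in E$, $\xi\in L^0_+(\mathcal F)$,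 $0\le\xi\le1$; a proper $f$ is lower semicontinuous if $\{x:f(x)\le r\}$ is closed for every $r\in L^0(\mathcal F)$. *)

theory Defs
  imports "HOL-Probability.Probability" "HOL-Algebra.Module"
begin

section \<open>Classes of random variables\<close>

definition ae_eq :: "'w measure \<Rightarrow> (('w \<Rightarrow> 'b::topological_space) \<times> ('w \<Rightarrow> 'b)) set" where
  "ae_eq M = {(f, g). f \<in> borel_measurable M \<and> g \<in> borel_measurable M \<and> (AE w in M. f w = g w)}"

definition ae_class :: "'w measure \<Rightarrow> ('w \<Rightarrow> 'b::topological_space) \<Rightarrow> ('w \<Rightarrow> 'b) set" where
  "ae_class M f = ae_eq M `` {f}"

definition ae_rep :: "('w \<Rightarrow> 'b) set \<Rightarrow> 'w \<Rightarrow> 'b" where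
  "ae_rep X = (SOME f. f \<in> X)"

definition L0 :: "'w measure \<Rightarrow> ('w \<Rightarrow> real) set set" where
  "L0 M = borel_measurable M // ae_eq M"

definition L0bar :: "'w measure \<Rightarrow> ('w \<Rightarrow> ereal) set set" where
  "L0bar M = borel_measurable M // ae_eq M"

definition ae_add :: "'w measure \<Rightarrow> ('w \<Rightarrow> 'b::{topological_space, plus}) set \<Rightarrow> ('w \<Rightarrow> 'b) set \<Rightarrow> ('w \<Rightarrow> 'b) set" where
  "ae_add M X Y = ae_class M (\<lambda>w. ae_rep X w + ae_rep Y w)"

definition ae_mult :: "'w measure \<Rightarrow> ('w \<Rightarrow> 'b::{topological_space, times}) set \<Rightarrow> ('w \<Rightarrow> 'b) set \<Rightarrow> ('w \<Rightarrow> 'b) set" where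
  "ae_mult M X Y = ae_class M (\<lambda>w. ae_rep X w * ae_rep Y w)"

definition ae_le :: "'w measure \<Rightarrow> ('w \<Rightarrow> 'b::ord) set \<Rightarrow> ('w \<Rightarrow> 'b) set \<Rightarrow> bool" where
  "ae_le M X Y \<longleftrightarrow> (AE w in M. ae_rep X w \<le> ae_rep Y w)"

definition L0_ring :: "'w measure \<Rightarrow> ('w \<Rightarrow> real) set ring" where
  "L0_ring M = \<lparr>carrier = L0 M, mult = ae_mult M, one = ae_class M (\<lambda>_. 1),
     zero = ae_class M (\<lambda>_. 0), add = ae_add M\<rparr>"

definition L0_abs :: "'w measure \<Rightarrow> ('w \<Rightarrow> real) set \<Rightarrow> ('w \<Rightarrow> real) set" where
  "L0_abs M X = ae_class M (\<lambda>w. \<bar>ae_rep X w\<bar>)"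

definition L0_ind :: "'w measure \<Rightarrow> 'w set \<Rightarrow> ('w \<Rightarrow> real) set" where
  "L0_ind M A = ae_class M (indicator A)"

definition L0_plus :: "'w measure \<Rightarrow> ('w \<Rightarrow> real) set set" where
  "L0_plus M = {X \<in> L0 M. AE w in M. 0 \<le> ae_rep X w}"

definition L0_pplus :: "'w measure \<Rightarrow> ('w \<Rightarrow> real) set set" where
  "L0_pplus M = {X \<in> L0 M. AE w in M. 0 < ae_rep X w}"

definition to_L0bar :: "'w measure \<Rightarrow> ('w \<Rightarrow> real) set \<Rightarrow> ('w \<Rightarrow> ereal) set" where
  "to_L0bar M X = ae_class M (\<lambda>w. ereal (ae_rep X w))"

text \<open>Meaningful only on a.s. finite classes, where it inverts \<^const>\<open>to_L0bar\<close>
  (\<^const>\<open>real_of_ereal\<close> sends infinite values to \<open>0\<close>).\<close>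
definition of_L0bar :: "'w measure \<Rightarrow> ('w \<Rightarrow> ereal) set \<Rightarrow> ('w \<Rightarrow> real) set" where
  "of_L0bar M X = ae_class M (\<lambda>w. real_of_ereal (ae_rep X w))"

lemma equiv_ae_eq: "equiv (borel_measurable M) (ae_eq M)"
proof (rule equivI)
  show "ae_eq M \<subseteq> borel_measurable M \<times> borel_measurable M" by (auto simp: ae_eq_def)
  show "refl_on (borel_measurable M) (ae_eq M)" by (auto simp: refl_on_def ae_eq_def)
  show "sym (ae_eq M)" by (auto simp: sym_def ae_eq_def eq_commute)
  show "trans (ae_eq M)"
  proof (rule transI)
    fix f g h
    assume fg: "(f, g) \<in> ae_eq M" and gh: "(g, h) \<in> ae_eq M"
    have "AE w in M. f w = g w" "AE w in M. g w = h w" using fg gh by (simp_all add: ae_eq_def)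
    then have "AE w in M. f w = h w" by eventually_elim simp
    with fg gh show "(f, h) \<in> ae_eq M" by (simp add: ae_eq_def)
  qed
qed

lemma ae_class_eq_iff:
  assumes "f \<in> borel_measurable M" "g \<in> borel_measurable M"
  shows "ae_class M f = ae_class M g \<longleftrightarrow> (AE w in M. f w = g w)"
  using eq_equiv_class_iff[OF equiv_ae_eq assms] assms by (simp add: ae_class_def ae_eq_def)

lemma ae_class_in_L0: "f \<in> borel_measurable M \<Longrightarrow> ae_class M f \<in> L0 M"
  unfolding L0_def ae_class_def by (rule quotientI)

lemma ae_class_in_L0bar: "f \<in> borel_measurable M \<Longrightarrow> ae_class M f \<in> L0bar M"
  unfolding L0bar_def ae_class_def by (rule quotientI)

lemma ae_rep_quotient:
  assumes "X \<in> borel_measurable M // ae_eq M"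
  shows "ae_rep X \<in> borel_measurable M" "ae_class M (ae_rep X) = X"
proof -
  from assms obtain f where f: "f \<in> borel_measurable M" "X = ae_eq M `` {f}"
    by (rule quotientE)
  then have "f \<in> X" by (simp add: ae_eq_def)
  then have "ae_rep X \<in> X" unfolding ae_rep_def by (rule someI[where P = "\<lambda>f. f \<in> X"])
  with f(2) have *: "(f, ae_rep X) \<in> ae_eq M" by simp
  then show "ae_rep X \<in> borel_measurable M" by (simp add: ae_eq_def)
  show "ae_class M (ae_rep X) = X"
    unfolding ae_class_def f(2)[symmetric] using equiv_class_eq[OF equiv_ae_eq *] f(2) by simp
qed

lemma ae_rep_L0:
  assumes "X \<in> L0 M"
  shows "ae_rep X \<in> borel_measurable M" "ae_class M (ae_rep X) = X"
  using assms by (simp_all add: L0_def ae_rep_quotient)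

lemma AE_ae_rep_class:
  assumes "f \<in> borel_measurable M"
  shows "AE w in M. ae_rep (ae_class M f) w = f w"
proof -
  have *: "ae_class M f \<in> borel_measurable M // ae_eq M"
    unfolding ae_class_def using assms by (rule quotientI)
  show ?thesis using ae_rep_quotient[OF *] assms by (simp add: ae_class_eq_iff)
qed

lemma ae_add_class:
  fixes f g :: "'w \<Rightarrow> real"
  assumes "f \<in> borel_measurable M" "g \<in> borel_measurable M"
  shows "ae_add M (ae_class M f) (ae_class M g) = ae_class M (\<lambda>w. f w + g w)"
proof -
  have "ae_rep (ae_class M f) \<in> borel_measurable M" "ae_rep (ae_class M g) \<in> borel_measurable M"
    by (intro ae_rep_L0(1) ae_class_in_L0 assms)+
  moreover have "AE w in M. ae_rep (ae_class M f) w + ae_rep (ae_class M g) w = f w + g w"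
    using AE_ae_rep_class[OF assms(1)] AE_ae_rep_class[OF assms(2)] by eventually_elim simp
  ultimately show ?thesis unfolding ae_add_def using assms by (simp add: ae_class_eq_iff)
qed

lemma ae_mult_class:
  fixes f g :: "'w \<Rightarrow> real"
  assumes "f \<in> borel_measurable M" "g \<in> borel_measurable M"
  shows "ae_mult M (ae_class M f) (ae_class M g) = ae_class M (\<lambda>w. f w * g w)"
proof -
  have "ae_rep (ae_class M f) \<in> borel_measurable M" "ae_rep (ae_class M g) \<in> borel_measurable M"
    by (intro ae_rep_L0(1) ae_class_in_L0 assms)+
  moreover have "AE w in M. ae_rep (ae_class M f) w * ae_rep (ae_class M g) w = f w * g w"
    using AE_ae_rep_class[OF assms(1)] AE_ae_rep_class[OF assms(2)] by eventually_elim simp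
  ultimately show ?thesis unfolding ae_mult_def using assms by (simp add: ae_class_eq_iff)
qed

lemma L0_cases:
  assumes "X \<in> L0 M"
  obtains f where "f \<in> borel_measurable M" "X = ae_class M f"
  using ae_rep_L0[OF assms] by metis

lemma L0_ring_simps:
  "carrier (L0_ring M) = L0 M" "mult (L0_ring M) = ae_mult M" "add (L0_ring M) = ae_add M"
  "one (L0_ring M) = ae_class M (\<lambda>_. 1)" "zero (L0_ring M) = ae_class M (\<lambda>_. 0)"
  by (simp_all add: L0_ring_def)

lemma cring_L0_ring: "cring (L0_ring M)"
proof (rule cringI)
  show "abelian_group (L0_ring M)"
  proof (rule abelian_groupI, unfold L0_ring_simps)
    fix X Y assume "X \<in> L0 M" "Y \<in> L0 M"
    then obtain f g where fg: "f \<in> borel_measurable M" "X = ae_class M f"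
      "g \<in> borel_measurable M" "Y = ae_class M g" by (elim L0_cases)
    then show "ae_add M X Y \<in> L0 M" "ae_add M X Y = ae_add M Y X"
      by (simp_all add: ae_add_class ae_class_in_L0 add.commute)
    fix Z assume "Z \<in> L0 M"
    then obtain h where "h \<in> borel_measurable M" "Z = ae_class M h" by (elim L0_cases)
    with fg show "ae_add M (ae_add M X Y) Z = ae_add M X (ae_add M Y Z)"
      by (simp add: ae_add_class add.assoc)
  next
    fix X assume "X \<in> L0 M"
    then obtain f where f: "f \<in> borel_measurable M" "X = ae_class M f" by (elim L0_cases)
    then show "ae_add M (ae_class M (\<lambda>_. 0)) X = X" by (simp add: ae_add_class)
    have "ae_add M (ae_class M (\<lambda>w. - f w)) X = ae_class M (\<lambda>_. 0)"
      using f by (simp add: ae_add_class)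
    moreover have "ae_class M (\<lambda>w. - f w) \<in> L0 M" using f by (simp add: ae_class_in_L0)
    ultimately show "\<exists>Y\<in>L0 M. ae_add M Y X = ae_class M (\<lambda>_. 0)" by (rule bexI)
  qed (simp add: ae_class_in_L0)
next
  show "comm_monoid (L0_ring M)"
  proof (rule comm_monoidI, unfold L0_ring_simps)
    fix X Y assume "X \<in> L0 M" "Y \<in> L0 M"
    then obtain f g where fg: "f \<in> borel_measurable M" "X = ae_class M f"
      "g \<in> borel_measurable M" "Y = ae_class M g" by (elim L0_cases)
    then show "ae_mult M X Y \<in> L0 M" "ae_mult M X Y = ae_mult M Y X"
      by (simp_all add: ae_mult_class ae_class_in_L0 mult.commute)
    fix Z assume "Z \<in> L0 M"
    then obtain h where "h \<in> borel_measurable M" "Z = ae_class M h" by (elim L0_cases)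
    with fg show "ae_mult M (ae_mult M X Y) Z = ae_mult M X (ae_mult M Y Z)"
      by (simp add: ae_mult_class mult.assoc)
  next
    fix X assume "X \<in> L0 M"
    then obtain f where "f \<in> borel_measurable M" "X = ae_class M f" by (elim L0_cases)
    then show "ae_mult M (ae_class M (\<lambda>_. 1)) X = X" by (simp add: ae_mult_class)
  qed (simp add: ae_class_in_L0)
next
  fix X Y Z assume "X \<in> carrier (L0_ring M)" "Y \<in> carrier (L0_ring M)" "Z \<in> carrier (L0_ring M)"
  then obtain f g h where "f \<in> borel_measurable M" "X = ae_class M f"
    "g \<in> borel_measurable M" "Y = ae_class M g" "h \<in> borel_measurable M" "Z = ae_class M h"
    unfolding L0_ring_simps by (elim L0_cases)
  then show "(X \<oplus>\<^bsub>L0_ring M\<^esub> Y) \<otimes>\<^bsub>L0_ring M\<^esub> Z =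
      X \<otimes>\<^bsub>L0_ring M\<^esub> Z \<oplus>\<^bsub>L0_ring M\<^esub> Y \<otimes>\<^bsub>L0_ring M\<^esub> Z"
    unfolding L0_ring_simps by (simp add: ae_add_class ae_mult_class distrib_right)
qed

definition L0_topology :: "'w measure \<Rightarrow> ('w \<Rightarrow> real) set topology" where
  "L0_topology M = topology (\<lambda>G. G \<subseteq> L0 M \<and> (\<forall>X\<in>G. \<exists>\<epsilon>\<in>L0_pplus M.
     {Y \<in> L0 M. ae_le M (L0_abs M (Y \<ominus>\<^bsub>L0_ring M\<^esub> X)) \<epsilon>} \<subseteq> G))"

lemma L0_pplus_common_lower:
  assumes "X \<in> L0_pplus M" "Y \<in> L0_pplus M"
  obtains Z where "Z \<in> L0_pplus M" "ae_le M Z X" "ae_le M Z Y"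
proof
  let ?f = "\<lambda>w. min (ae_rep X w) (ae_rep Y w)"
  have X: "ae_rep X \<in> borel_measurable M" "AE w in M. 0 < ae_rep X w"
    and Y: "ae_rep Y \<in> borel_measurable M" "AE w in M. 0 < ae_rep Y w"
    using assms by (simp_all add: L0_pplus_def ae_rep_L0)
  have f: "?f \<in> borel_measurable M" using X Y by simp
  note Z = AE_ae_rep_class[OF f]
  show "ae_class M ?f \<in> L0_pplus M"
    unfolding L0_pplus_def mem_Collect_eq
  proof
    show "AE w in M. 0 < ae_rep (ae_class M ?f) w" using Z X(2) Y(2) by eventually_elim simp
  qed (rule ae_class_in_L0[OF f])
  show "ae_le M (ae_class M ?f) X" "ae_le M (ae_class M ?f) Y"
    unfolding ae_le_def using Z by (eventually_elim, simp)+
qed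

lemma ae_le_trans:
  fixes X Y Z :: "('w \<Rightarrow> 'b::preorder) set"
  assumes "ae_le M X Y" "ae_le M Y Z"
  shows "ae_le M X Z"
  using assms unfolding ae_le_def by eventually_elim (rule order_trans)

lemma openin_L0_topology:
  "openin (L0_topology M) G \<longleftrightarrow> G \<subseteq> L0 M \<and> (\<forall>X\<in>G. \<exists>\<epsilon>\<in>L0_pplus M.
     {Y \<in> L0 M. ae_le M (L0_abs M (Y \<ominus>\<^bsub>L0_ring M\<^esub> X)) \<epsilon>} \<subseteq> G)"
proof -
  let ?B = "\<lambda>X \<epsilon>. {Y \<in> L0 M. ae_le M (L0_abs M (Y \<ominus>\<^bsub>L0_ring M\<^esub> X)) \<epsilon>}"
  have "istopology (\<lambda>G. G \<subseteq> L0 M \<and> (\<forall>X\<in>G. \<exists>\<epsilon>\<in>L0_pplus M. ?B X \<epsilon> \<subseteq> G))"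
    unfolding istopology_def
  proof safe
    fix S T X
    assume "\<forall>X\<in>S. \<exists>\<epsilon>\<in>L0_pplus M. ?B X \<epsilon> \<subseteq> S" "\<forall>X\<in>T. \<exists>\<epsilon>\<in>L0_pplus M. ?B X \<epsilon> \<subseteq> T" "X \<in> S" "X \<in> T"
    then obtain a b where ab: "a \<in> L0_pplus M" "b \<in> L0_pplus M" "?B X a \<subseteq> S" "?B X b \<subseteq> T"
      by blast
    obtain c where "c \<in> L0_pplus M" "ae_le M c a" "ae_le M c b"
      using L0_pplus_common_lower[OF ab(1,2)] .
    moreover from this have "?B X c \<subseteq> ?B X a" "?B X c \<subseteq> ?B X b"
      using ae_le_trans[of M _ c a] ae_le_trans[of M _ c b] by blast+
    ultimately show "\<exists>\<epsilon>\<in>L0_pplus M. ?B X \<epsilon> \<subseteq> S \<inter> T"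
      using ab(3,4) by (meson Int_greatest order_trans)
  next
    fix \<K> X S assume "\<forall>K\<in>\<K>. K \<subseteq> L0 M \<and> (\<forall>X\<in>K. \<exists>\<epsilon>\<in>L0_pplus M. ?B X \<epsilon> \<subseteq> K)" "X \<in> S" "S \<in> \<K>"
    then show "X \<in> L0 M" by blast
  next
    fix \<K> X S assume "\<forall>K\<in>\<K>. K \<subseteq> L0 M \<and> (\<forall>X\<in>K. \<exists>\<epsilon>\<in>L0_pplus M. ?B X \<epsilon> \<subseteq> K)" "X \<in> S" "S \<in> \<K>"
    then show "\<exists>\<epsilon>\<in>L0_pplus M. ?B X \<epsilon> \<subseteq> \<Union> \<K>"
      by (meson Union_upper order_trans)
  qed blast
  then show ?thesis unfolding L0_topology_def by (simp add: topology_inverse')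
qed

section \<open>Locally \<open>L\<^sup>0\<close>-convex modules\<close>

text \<open>Empty pieces are allowed, so that finite partitions are covered.\<close>
definition countable_partition :: "'w measure \<Rightarrow> (nat \<Rightarrow> 'w set) \<Rightarrow> bool" where
  "countable_partition M A \<longleftrightarrow> range A \<subseteq> sets M \<and> disjoint_family A \<and> (\<Union>n. A n) = space M"

locale L0_module = prob_space M + E: module "L0_ring M" E
  for M :: "'w measure" and E :: "(('w \<Rightarrow> real) set, 'e) module" +
  assumes regular: "\<And>x y A. x \<in> carrier E \<Longrightarrow> y \<in> carrier E \<Longrightarrow> countable_partition M A \<Longrightarrow>
    (\<And>n. L0_ind M (A n) \<odot>\<^bsub>E\<^esub> x = L0_ind M (A n) \<odot>\<^bsub>E\<^esub> y) \<Longrightarrow> x = y"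

definition L0_balanced :: "'w measure \<Rightarrow> (('w \<Rightarrow> real) set, 'e) module \<Rightarrow> 'e set \<Rightarrow> bool" where
  "L0_balanced M E B \<longleftrightarrow> B \<subseteq> carrier E \<and>
     (\<forall>\<eta>\<in>L0 M. ae_le M (L0_abs M \<eta>) \<one>\<^bsub>L0_ring M\<^esub> \<longrightarrow> (\<forall>x\<in>B. \<eta> \<odot>\<^bsub>E\<^esub> x \<in> B))"

definition L0_convex :: "'w measure \<Rightarrow> (('w \<Rightarrow> real) set, 'e) module \<Rightarrow> 'e set \<Rightarrow> bool" where
  "L0_convex M E B \<longleftrightarrow> B \<subseteq> carrier E \<and>
     (\<forall>x\<in>B. \<forall>y\<in>B. \<forall>\<xi>\<in>L0_plus M. ae_le M \<xi> \<one>\<^bsub>L0_ring M\<^esub> \<longrightarrow>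
        \<xi> \<odot>\<^bsub>E\<^esub> x \<oplus>\<^bsub>E\<^esub> (\<one>\<^bsub>L0_ring M\<^esub> \<ominus>\<^bsub>L0_ring M\<^esub> \<xi>) \<odot>\<^bsub>E\<^esub> y \<in> B)"

definition L0_absorbent :: "'w measure \<Rightarrow> (('w \<Rightarrow> real) set, 'e) module \<Rightarrow> 'e set \<Rightarrow> bool" where
  "L0_absorbent M E B \<longleftrightarrow> B \<subseteq> carrier E \<and>
     (\<forall>x\<in>carrier E. \<exists>\<xi>\<in>L0_pplus M. \<forall>\<eta>\<in>L0 M. ae_le M (L0_abs M \<eta>) \<xi> \<longrightarrow> \<eta> \<odot>\<^bsub>E\<^esub> x \<in> B)"

definition countable_concatenation :: "'w measure \<Rightarrow> (('w \<Rightarrow> real) set, 'e) module \<Rightarrow> 'e set \<Rightarrow> bool" where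
  "countable_concatenation M E G \<longleftrightarrow>
     (\<forall>x A. range x \<subseteq> G \<longrightarrow> countable_partition M A \<longrightarrow>
        (\<exists>y\<in>G. \<forall>n::nat. L0_ind M (A n) \<odot>\<^bsub>E\<^esub> y = L0_ind M (A n) \<odot>\<^bsub>E\<^esub> x n))"

locale locally_L0_convex_module = L0_module M E
  for M :: "'w measure" and E :: "(('w \<Rightarrow> real) set, 'e) module" +
  fixes T :: "'e topology"
  assumes topspace_eq: "topspace T = carrier E"
    and continuous_add: "continuous_map (prod_topology T T) T (\<lambda>(x, y). x \<oplus>\<^bsub>E\<^esub> y)"
    and continuous_smult:
      "continuous_map (prod_topology (L0_topology M) T) T (\<lambda>(\<xi>, x). \<xi> \<odot>\<^bsub>E\<^esub> x)"
    and local_base: "neighbourhood_base_at \<zero>\<^bsub>E\<^esub>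
      (\<lambda>U. L0_balanced M E U \<and> L0_absorbent M E U \<and> L0_convex M E U) T"

definition L0_barrel :: "'w measure \<Rightarrow> (('w \<Rightarrow> real) set, 'e) module \<Rightarrow> 'e topology \<Rightarrow> 'e set \<Rightarrow> bool" where
  "L0_barrel M E T B \<longleftrightarrow>
     L0_balanced M E B \<and> L0_absorbent M E B \<and> L0_convex M E B \<and> closedin T B"

locale L0_pre_barreled_module = locally_L0_convex_module M E T
  for M :: "'w measure" and E :: "(('w \<Rightarrow> real) set, 'e) module" and T :: "'e topology" +
  assumes pre_barreled: "\<And>B. L0_barrel M E T B \<Longrightarrow> countable_concatenation M E B \<Longrightarrow>
    \<zero>\<^bsub>E\<^esub> \<in> T interior_of B"

section \<open>Functions with values in \<open>L0bar\<close>\<close>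

definition L0_dom :: "'w measure \<Rightarrow> (('w \<Rightarrow> real) set, 'e) module \<Rightarrow> ('e \<Rightarrow> ('w \<Rightarrow> ereal) set) \<Rightarrow> 'e set" where
  "L0_dom M E f = {x \<in> carrier E. AE w in M. \<bar>ae_rep (f x) w\<bar> < \<infinity>}"

definition L0_proper :: "'w measure \<Rightarrow> (('w \<Rightarrow> real) set, 'e) module \<Rightarrow> ('e \<Rightarrow> ('w \<Rightarrow> ereal) set) \<Rightarrow> bool" where
  "L0_proper M E f \<longleftrightarrow> L0_dom M E f \<noteq> {} \<and> (\<forall>x\<in>carrier E. AE w in M. ae_rep (f x) w > -\<infinity>)"

text \<open>The library conventions \<open>0 * \<plusminus>\<infinity> = 0\<close> and \<open>\<infinity> + -\<infinity> = \<infinity>\<close> on \<^typ>\<open>ereal\<close>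
  are the ones intended here.\<close>
definition L0_convex_fun :: "'w measure \<Rightarrow> (('w \<Rightarrow> real) set, 'e) module \<Rightarrow> ('e \<Rightarrow> ('w \<Rightarrow> ereal) set) \<Rightarrow> bool" where
  "L0_convex_fun M E f \<longleftrightarrow>
     (\<forall>x\<in>carrier E. \<forall>y\<in>carrier E. \<forall>\<xi>\<in>L0_plus M. ae_le M \<xi> \<one>\<^bsub>L0_ring M\<^esub> \<longrightarrow>
        ae_le M (f (\<xi> \<odot>\<^bsub>E\<^esub> x \<oplus>\<^bsub>E\<^esub> (\<one>\<^bsub>L0_ring M\<^esub> \<ominus>\<^bsub>L0_ring M\<^esub> \<xi>) \<odot>\<^bsub>E\<^esub> y))
          (ae_add M (ae_mult M (to_L0bar M \<xi>) (f x))
             (ae_mult M (to_L0bar M (\<one>\<^bsub>L0_ring M\<^esub> \<ominus>\<^bsub>L0_ring M\<^esub> \<xi>)) (f y))))"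

definition L0_lsc :: "'w measure \<Rightarrow> (('w \<Rightarrow> real) set, 'e) module \<Rightarrow> 'e topology \<Rightarrow> ('e \<Rightarrow> ('w \<Rightarrow> ereal) set) \<Rightarrow> bool" where
  "L0_lsc M E T f \<longleftrightarrow> (\<forall>r\<in>L0 M. closedin T {x \<in> carrier E. ae_le M (f x) (to_L0bar M r)})"

end

theory Submission
  imports Defs
begin

text \<open>Fix \<open>a\<close> in the interior of the domain and \<open>\<epsilon> \<in> L\<^sup>0\<^sub>+\<^sub>+\<close>, let \<open>C = {f \<le> f(a) + \<epsilon>}\<close> and
  \<open>B = (C - a) \<inter> (a - C)\<close>. Convexity, lower semicontinuity and the locality of \<open>f\<close> make \<open>B\<close> an
  \<open>L\<^sup>0\<close>-barrel with the countable concatenation property; it is absorbent because \<open>f\<close> is finite near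
  \<open>a\<close>. So \<open>B\<close> is a neighbourhood of \<open>0\<close>. If \<open>x - a \<in> B\<close> then \<open>f(x) \<le> f(a) + \<epsilon>\<close>, and since \<open>a\<close> is the
  midpoint of \<open>x\<close> and \<open>2a - x \<in> C\<close>, also \<open>f(x) \<ge> f(a) - \<epsilon>\<close>.\<close>

section \<open>Calculus of representatives\<close>

lemma L0_ring_minus_class:
  fixes f g :: "'w \<Rightarrow> real"
  assumes [measurable]: "f \<in> borel_measurable M" "g \<in> borel_measurable M"
  shows "ae_class M f \<ominus>\<^bsub>L0_ring M\<^esub> ae_class M g = ae_class M (\<lambda>w. f w - g w)"
proof -
  interpret cring "L0_ring M" by (rule cring_L0_ring)
  have "\<ominus>\<^bsub>L0_ring M\<^esub> ae_class M g = ae_class M (\<lambda>w. - g w)"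
    by (rule minus_equality) (simp_all add: L0_ring_simps ae_add_class ae_class_in_L0)
  then show ?thesis by (simp add: a_minus_def L0_ring_simps ae_add_class)
qed

lemma L0_abs_class:
  assumes [measurable]: "f \<in> borel_measurable M"
  shows "L0_abs M (ae_class M f) = ae_class M (\<lambda>w. \<bar>f w\<bar>)"
proof -
  have [measurable]: "ae_rep (ae_class M f) \<in> borel_measurable M"
    by (intro ae_rep_L0(1) ae_class_in_L0 assms)
  have "AE w in M. \<bar>ae_rep (ae_class M f) w\<bar> = \<bar>f w\<bar>"
    using AE_ae_rep_class[OF assms] by eventually_elim simp
  then show ?thesis unfolding L0_abs_def by (simp add: ae_class_eq_iff)
qed

text \<open>\<open>ae_rep\<close> is a choice, but any two representatives differ only on a null
  set, which an almost-everywhere statement cannot see. \<open>P\<close> may depend on the point, so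
  several representatives can be replaced one after the other.\<close>

lemma AE_rep_class_iff:
  assumes "f \<in> borel_measurable M"
  shows "(AE w in M. P w (ae_rep (ae_class M f) w)) \<longleftrightarrow> (AE w in M. P w (f w))"
proof
  assume "AE w in M. P w (ae_rep (ae_class M f) w)"
  with AE_ae_rep_class[OF assms] show "AE w in M. P w (f w)" by eventually_elim simp
next
  assume "AE w in M. P w (f w)"
  with AE_ae_rep_class[OF assms] show "AE w in M. P w (ae_rep (ae_class M f) w)"
    by eventually_elim simp
qed

lemma ae_le_class_iff:
  fixes f g :: "'w \<Rightarrow> 'b::{topological_space, ord}"
  assumes "f \<in> borel_measurable M" "g \<in> borel_measurable M"
  shows "ae_le M (ae_class M f) (ae_class M g) \<longleftrightarrow> (AE w in M. f w \<le> g w)"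
  unfolding ae_le_def
  using AE_rep_class_iff[OF assms(1), of "\<lambda>w a. a \<le> ae_rep (ae_class M g) w"]
    AE_rep_class_iff[OF assms(2), of "\<lambda>w a. f w \<le> a"] by simp

lemma L0_plus_class_iff:
  assumes "f \<in> borel_measurable M"
  shows "ae_class M f \<in> L0_plus M \<longleftrightarrow> (AE w in M. 0 \<le> f w)"
  using AE_rep_class_iff[OF assms, of "\<lambda>w a. 0 \<le> a"]
  by (simp add: L0_plus_def ae_class_in_L0 assms)

lemma L0_pplus_class_iff:
  assumes "f \<in> borel_measurable M"
  shows "ae_class M f \<in> L0_pplus M \<longleftrightarrow> (AE w in M. 0 < f w)"
  using AE_rep_class_iff[OF assms, of "\<lambda>w a. 0 < a"]
  by (simp add: L0_pplus_def ae_class_in_L0 assms)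

lemma L0_pplus_cases:
  assumes "X \<in> L0_pplus M"
  obtains f where "f \<in> borel_measurable M" "AE w in M. 0 < f w" "X = ae_class M f"
proof -
  from assms have "X \<in> L0 M" by (simp add: L0_pplus_def)
  then obtain f where "f \<in> borel_measurable M" "X = ae_class M f" by (rule L0_cases)
  with assms show ?thesis by (intro that) (simp_all add: L0_pplus_class_iff)
qed

lemma ae_rep_L0bar:
  assumes "X \<in> L0bar M"
  shows "ae_rep X \<in> borel_measurable M" "ae_class M (ae_rep X) = X"
  using assms by (simp_all add: L0bar_def ae_rep_quotient)

text \<open>\<open>to_L0bar\<close> nests two choices of representative; each changes the right-hand
  side only on a null set. This turns the order used in lower semicontinuity into a pointwise
  inequality.\<close>

lemma ae_le_to_L0bar_iff:
  assumes X: "X \<in> L0bar M" and r [measurable]: "r \<in> borel_measurable M"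
  shows "ae_le M X (to_L0bar M (ae_class M r)) \<longleftrightarrow> (AE w in M. ae_rep X w \<le> ereal (r w))"
proof -
  have [measurable]: "ae_rep (ae_class M r) \<in> borel_measurable M"
    by (intro ae_rep_L0(1) ae_class_in_L0 r)
  have "ae_le M (ae_class M (ae_rep X)) (to_L0bar M (ae_class M r)) \<longleftrightarrow>
      (AE w in M. ae_rep X w \<le> ereal (ae_rep (ae_class M r) w))"
    unfolding to_L0bar_def by (rule ae_le_class_iff) (use ae_rep_L0bar[OF X] in simp_all)
  also have "\<dots> \<longleftrightarrow> (AE w in M. ae_rep X w \<le> ereal (r w))"
    by (rule AE_rep_class_iff[OF r, of "\<lambda>w a. ae_rep X w \<le> ereal a"])
  finally show ?thesis using ae_rep_L0bar[OF X] by simp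
qed

lemma topspace_L0_topology: "topspace (L0_topology M) = L0 M"
proof -
  \<comment> \<open>Openness of the whole space still asks for some positive radius; the constant 1
    provides it.\<close>
  have "ae_class M (\<lambda>_. 1) \<in> L0_pplus M" by (simp add: L0_pplus_class_iff)
  then have "openin (L0_topology M) (L0 M)" unfolding openin_L0_topology by blast
  then show ?thesis
    using openin_L0_topology[of M "topspace (L0_topology M)"] openin_subset[of "L0_topology M"]
    by auto
qed

section \<open>Modules over \<open>L\<^sup>0\<close>\<close>

lemma L0_convex_iff:
  fixes M :: "'w measure"
  shows "L0_convex M E B \<longleftrightarrow> B \<subseteq> carrier E \<and>
     (\<forall>x\<in>B. \<forall>y\<in>B. \<forall>g\<in>borel_measurable M. (AE w in M. 0 \<le> g w) \<longrightarrow> (AE w in M. g w \<le> 1) \<longrightarrow>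
        ae_class M g \<odot>\<^bsub>E\<^esub> x \<oplus>\<^bsub>E\<^esub> ae_class M (\<lambda>w. 1 - g w) \<odot>\<^bsub>E\<^esub> y \<in> B)"
proof -
  \<comment> \<open>Only the scalar quantifier has to be translated. The predicate \<open>P\<close>
    on the two weights abstracts from the vectors, so that the equivalence can be used below the
    quantifiers over \<open>x\<close> and \<open>y\<close>.\<close>
  have scalars: "(\<forall>\<xi>\<in>L0_plus M. ae_le M \<xi> \<one>\<^bsub>L0_ring M\<^esub> \<longrightarrow> P \<xi> (\<one>\<^bsub>L0_ring M\<^esub> \<ominus>\<^bsub>L0_ring M\<^esub> \<xi>)) \<longleftrightarrow>
      (\<forall>g\<in>borel_measurable M. (AE w in M. 0 \<le> g w) \<longrightarrow> (AE w in M. g w \<le> 1) \<longrightarrow>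
        P (ae_class M g) (ae_class M (\<lambda>w. 1 - g w)))" (is "?L = ?R") for P
  proof
    assume L: ?L
    show ?R
    proof (intro ballI impI)
      fix g :: "'w \<Rightarrow> real"
      assume g: "g \<in> borel_measurable M" "AE w in M. 0 \<le> g w" "AE w in M. g w \<le> 1"
      then have "P (ae_class M g) (\<one>\<^bsub>L0_ring M\<^esub> \<ominus>\<^bsub>L0_ring M\<^esub> ae_class M g)"
        using L by (simp add: L0_ring_simps L0_plus_class_iff ae_le_class_iff)
      with g show "P (ae_class M g) (ae_class M (\<lambda>w. 1 - g w))"
        using L0_ring_minus_class[of "\<lambda>_. 1" M g] by (simp add: L0_ring_simps(4))
    qed
  next
    assume R: ?R
    show ?L
    proof (intro ballI impI)
      fix \<xi> assume \<xi>: "\<xi> \<in> L0_plus M" "ae_le M \<xi> \<one>\<^bsub>L0_ring M\<^esub>"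
      then obtain g where g: "g \<in> borel_measurable M" "\<xi> = ae_class M g"
        by (auto simp: L0_plus_def elim: L0_cases)
      with R \<xi> show "P \<xi> (\<one>\<^bsub>L0_ring M\<^esub> \<ominus>\<^bsub>L0_ring M\<^esub> \<xi>)"
        by (auto simp: L0_ring_simps L0_plus_class_iff ae_le_class_iff L0_ring_minus_class)
    qed
  qed
  show ?thesis
    unfolding L0_convex_def
    by (simp only: scalars[of "\<lambda>a b. a \<odot>\<^bsub>E\<^esub> _ \<oplus>\<^bsub>E\<^esub> b \<odot>\<^bsub>E\<^esub> _ \<in> B"])
qed

lemma L0_balanced_iff:
  "L0_balanced M E B \<longleftrightarrow> B \<subseteq> carrier E \<and>
     (\<forall>g\<in>borel_measurable M. (AE w in M. \<bar>g w\<bar> \<le> 1) \<longrightarrow> (\<forall>x\<in>B. ae_class M g \<odot>\<^bsub>E\<^esub> x \<in> B))"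
  (is "_ \<longleftrightarrow> _ \<and> ?R")
proof -
  have "?R \<longleftrightarrow> (\<forall>\<eta>\<in>L0 M. ae_le M (L0_abs M \<eta>) \<one>\<^bsub>L0_ring M\<^esub> \<longrightarrow> (\<forall>x\<in>B. \<eta> \<odot>\<^bsub>E\<^esub> x \<in> B))" (is "_ = ?L")
  proof
    assume R: ?R
    show ?L
    proof (intro ballI impI)
      fix \<eta> x assume \<eta>: "\<eta> \<in> L0 M" "ae_le M (L0_abs M \<eta>) \<one>\<^bsub>L0_ring M\<^esub>" and x: "x \<in> B"
      obtain g where g: "g \<in> borel_measurable M" "\<eta> = ae_class M g" using \<eta>(1) by (rule L0_cases)
      with R \<eta> x show "\<eta> \<odot>\<^bsub>E\<^esub> x \<in> B"
        by (auto simp: L0_ring_simps L0_abs_class ae_le_class_iff)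
    qed
  next
    assume ?L
    then show ?R by (auto simp: L0_ring_simps L0_abs_class ae_le_class_iff ae_class_in_L0)
  qed
  then show ?thesis unfolding L0_balanced_def by simp
qed

text \<open>For \<open>C\<close> inside the carrier this is the largest subset of
  \<open>C - a\<close> that is symmetric about zero. Written as an intersection of two preimages of
  \<open>C\<close>, it inherits convexity, closedness and concatenation from
  \<open>C\<close>.\<close>

definition symmetrization :: "('a, 'e, 'm) module_scheme \<Rightarrow> 'e \<Rightarrow> 'e set \<Rightarrow> 'e set" where
  "symmetrization E a C = {z \<in> carrier E. a \<oplus>\<^bsub>E\<^esub> z \<in> C \<and> a \<ominus>\<^bsub>E\<^esub> z \<in> C}"

section \<open>Scalar arithmetic and algebraic properties of symmetrized sets\<close>

context L0_module
begin

lemma class_closed [simp]: "g \<in> borel_measurable M \<Longrightarrow> ae_class M g \<in> carrier (L0_ring M)"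
  by (simp add: L0_ring_simps ae_class_in_L0)

lemma smult_add_class:
  assumes "g \<in> borel_measurable M" "h \<in> borel_measurable M" "x \<in> carrier E"
  shows "ae_class M g \<odot>\<^bsub>E\<^esub> x \<oplus>\<^bsub>E\<^esub> ae_class M h \<odot>\<^bsub>E\<^esub> x = ae_class M (\<lambda>w. g w + h w) \<odot>\<^bsub>E\<^esub> x"
  using E.smult_l_distr[of "ae_class M g" "ae_class M h" x] assms
  by (simp add: L0_ring_simps ae_add_class ae_class_in_L0)

lemma smult_smult_class:
  assumes "g \<in> borel_measurable M" "h \<in> borel_measurable M" "x \<in> carrier E"
  shows "ae_class M g \<odot>\<^bsub>E\<^esub> (ae_class M h \<odot>\<^bsub>E\<^esub> x) = ae_class M (\<lambda>w. g w * h w) \<odot>\<^bsub>E\<^esub> x"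
  using E.smult_assoc1[of "ae_class M g" "ae_class M h" x] assms
  by (simp add: L0_ring_simps ae_mult_class ae_class_in_L0)

lemma smult_one_class: "x \<in> carrier E \<Longrightarrow> ae_class M (\<lambda>_. 1) \<odot>\<^bsub>E\<^esub> x = x"
  using E.smult_one by (simp add: L0_ring_simps)

lemma smult_zero_class: "x \<in> carrier E \<Longrightarrow> ae_class M (\<lambda>_. 0) \<odot>\<^bsub>E\<^esub> x = \<zero>\<^bsub>E\<^esub>"
  using E.smult_l_null by (simp add: L0_ring_simps)

lemma smult_uminus_class:
  assumes "g \<in> borel_measurable M" "x \<in> carrier E"
  shows "ae_class M (\<lambda>w. - g w) \<odot>\<^bsub>E\<^esub> x = \<ominus>\<^bsub>E\<^esub> (ae_class M g \<odot>\<^bsub>E\<^esub> x)"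
proof -
  have "ae_class M (\<lambda>w. - g w) \<odot>\<^bsub>E\<^esub> x \<oplus>\<^bsub>E\<^esub> ae_class M g \<odot>\<^bsub>E\<^esub> x = \<zero>\<^bsub>E\<^esub>"
    using assms by (simp add: smult_add_class smult_zero_class)
  then show ?thesis using assms by (intro E.minus_equality[symmetric]) auto
qed

lemma minus_eq_smult_class: "x \<in> carrier E \<Longrightarrow> \<ominus>\<^bsub>E\<^esub> x = ae_class M (\<lambda>_. - 1) \<odot>\<^bsub>E\<^esub> x"
  using smult_uminus_class[of "\<lambda>_. 1" x] by (simp add: smult_one_class)

text \<open>The weights \<open>g\<close> and \<open>1 - g\<close> add up to one, so \<open>a\<close>
  itself splits as \<open>g a + (1 - g) a\<close> and can be distributed over the two terms.\<close>

lemma add_convex_combination: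
  assumes g: "g \<in> borel_measurable M" and x: "x \<in> carrier E" "y \<in> carrier E" "a \<in> carrier E"
  shows "a \<oplus>\<^bsub>E\<^esub> (ae_class M g \<odot>\<^bsub>E\<^esub> x \<oplus>\<^bsub>E\<^esub> ae_class M (\<lambda>w. 1 - g w) \<odot>\<^bsub>E\<^esub> y) =
    ae_class M g \<odot>\<^bsub>E\<^esub> (a \<oplus>\<^bsub>E\<^esub> x) \<oplus>\<^bsub>E\<^esub> ae_class M (\<lambda>w. 1 - g w) \<odot>\<^bsub>E\<^esub> (a \<oplus>\<^bsub>E\<^esub> y)"
proof -
  have "a = ae_class M g \<odot>\<^bsub>E\<^esub> a \<oplus>\<^bsub>E\<^esub> ae_class M (\<lambda>w. 1 - g w) \<odot>\<^bsub>E\<^esub> a"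
    using g x by (simp add: smult_add_class smult_one_class)
  then have "a \<oplus>\<^bsub>E\<^esub> (ae_class M g \<odot>\<^bsub>E\<^esub> x \<oplus>\<^bsub>E\<^esub> ae_class M (\<lambda>w. 1 - g w) \<odot>\<^bsub>E\<^esub> y) =
    (ae_class M g \<odot>\<^bsub>E\<^esub> a \<oplus>\<^bsub>E\<^esub> ae_class M (\<lambda>w. 1 - g w) \<odot>\<^bsub>E\<^esub> a) \<oplus>\<^bsub>E\<^esub>
    (ae_class M g \<odot>\<^bsub>E\<^esub> x \<oplus>\<^bsub>E\<^esub> ae_class M (\<lambda>w. 1 - g w) \<odot>\<^bsub>E\<^esub> y)" by simp
  also have "\<dots> = ae_class M g \<odot>\<^bsub>E\<^esub> (a \<oplus>\<^bsub>E\<^esub> x) \<oplus>\<^bsub>E\<^esub> ae_class M (\<lambda>w. 1 - g w) \<odot>\<^bsub>E\<^esub> (a \<oplus>\<^bsub>E\<^esub> y)"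
    using g x by (simp add: E.smult_r_distr E.add.m_ac)
  finally show ?thesis .
qed

lemma minus_convex_combination:
  assumes g: "g \<in> borel_measurable M" and x: "x \<in> carrier E" "y \<in> carrier E" "a \<in> carrier E"
  shows "a \<ominus>\<^bsub>E\<^esub> (ae_class M g \<odot>\<^bsub>E\<^esub> x \<oplus>\<^bsub>E\<^esub> ae_class M (\<lambda>w. 1 - g w) \<odot>\<^bsub>E\<^esub> y) =
    ae_class M g \<odot>\<^bsub>E\<^esub> (a \<ominus>\<^bsub>E\<^esub> x) \<oplus>\<^bsub>E\<^esub> ae_class M (\<lambda>w. 1 - g w) \<odot>\<^bsub>E\<^esub> (a \<ominus>\<^bsub>E\<^esub> y)"
proof -
  have "\<ominus>\<^bsub>E\<^esub> (ae_class M g \<odot>\<^bsub>E\<^esub> x \<oplus>\<^bsub>E\<^esub> ae_class M (\<lambda>w. 1 - g w) \<odot>\<^bsub>E\<^esub> y) =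
      ae_class M g \<odot>\<^bsub>E\<^esub> (\<ominus>\<^bsub>E\<^esub> x) \<oplus>\<^bsub>E\<^esub> ae_class M (\<lambda>w. 1 - g w) \<odot>\<^bsub>E\<^esub> (\<ominus>\<^bsub>E\<^esub> y)"
    using g x by (simp add: E.minus_add E.smult_r_minus)
  then show ?thesis
    using add_convex_combination[of g "\<ominus>\<^bsub>E\<^esub> x" "\<ominus>\<^bsub>E\<^esub> y" a] g x by (simp add: a_minus_def)
qed

text \<open>Both maps \<open>z \<mapsto> a + z\<close> and \<open>z \<mapsto> a - z\<close> respect
  convex combinations, so preimages of \<open>C\<close> under them are convex.\<close>

lemma convex_symmetrization:
  assumes C: "L0_convex M E C" and a: "a \<in> carrier E"
  shows "L0_convex M E (symmetrization E a C)"
proof -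
  have "symmetrization E a C \<subseteq> carrier E" by (auto simp: symmetrization_def)
  moreover have "ae_class M g \<odot>\<^bsub>E\<^esub> x \<oplus>\<^bsub>E\<^esub> ae_class M (\<lambda>w. 1 - g w) \<odot>\<^bsub>E\<^esub> y \<in> symmetrization E a C"
    if "x \<in> symmetrization E a C" "y \<in> symmetrization E a C" "g \<in> borel_measurable M"
      "AE w in M. 0 \<le> g w" "AE w in M. g w \<le> 1" for x y g
    using that C a
    by (auto simp: symmetrization_def L0_convex_iff add_convex_combination minus_convex_combination)
  ultimately show ?thesis unfolding L0_convex_iff by blast
qed

text \<open>A convex set symmetric about zero is balanced: for \<open>\<bar>g\<bar> \<le> 1\<close>
  the weight \<open>h = (1 + g) / 2\<close> lies between 0 and 1, and
  \<open>g x = h x + (1 - h) (- x)\<close>.\<close>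

lemma balanced_symmetrization:
  assumes C: "L0_convex M E C" and a: "a \<in> carrier E"
  shows "L0_balanced M E (symmetrization E a C)"
  unfolding L0_balanced_iff
proof (intro conjI ballI impI)
  show "symmetrization E a C \<subseteq> carrier E" by (auto simp: symmetrization_def)
next
  fix g :: "_ \<Rightarrow> real" and x assume g [measurable]: "g \<in> borel_measurable M" and g1: "AE w in M. \<bar>g w\<bar> \<le> 1"
    and x: "x \<in> symmetrization E a C"
  let ?h = "\<lambda>w. (1 + g w) / 2"
  have xE: "x \<in> carrier E" using x by (simp add: symmetrization_def)
  have "\<ominus>\<^bsub>E\<^esub> x \<in> symmetrization E a C" using x a by (simp add: symmetrization_def a_minus_def)
  moreover have "AE w in M. 0 \<le> ?h w" "AE w in M. ?h w \<le> 1"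
    using g1 by (eventually_elim, simp)+
  ultimately have
    "ae_class M ?h \<odot>\<^bsub>E\<^esub> x \<oplus>\<^bsub>E\<^esub> ae_class M (\<lambda>w. 1 - ?h w) \<odot>\<^bsub>E\<^esub> (\<ominus>\<^bsub>E\<^esub> x) \<in> symmetrization E a C"
    using convex_symmetrization[OF C a] x by (auto simp: L0_convex_iff)
  also have "ae_class M ?h \<odot>\<^bsub>E\<^esub> x \<oplus>\<^bsub>E\<^esub> ae_class M (\<lambda>w. 1 - ?h w) \<odot>\<^bsub>E\<^esub> (\<ominus>\<^bsub>E\<^esub> x) =
      ae_class M (\<lambda>w. ?h w + (1 - ?h w) * (- 1)) \<odot>\<^bsub>E\<^esub> x"
    using xE by (simp only: minus_eq_smult_class) (simp add: smult_add_class smult_smult_class)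
  also have "(\<lambda>w. ?h w + (1 - ?h w) * (- 1)) = g" by (simp add: fun_eq_iff field_simps)
  finally show "ae_class M g \<odot>\<^bsub>E\<^esub> x \<in> symmetrization E a C" .
qed

text \<open>One positive multiple \<open>g x\<close> in \<open>B\<close> is enough: if
  \<open>\<bar>h\<bar> \<le> g\<close>, then \<open>h x = (h / g) (g x)\<close> with a factor of
  modulus at most one.\<close>

lemma balanced_absorbentI:
  assumes B: "L0_balanced M E B"
    and abs: "\<And>x. x \<in> carrier E \<Longrightarrow> \<exists>g\<in>borel_measurable M. (AE w in M. 0 < g w) \<and> ae_class M g \<odot>\<^bsub>E\<^esub> x \<in> B"
  shows "L0_absorbent M E B"
  unfolding L0_absorbent_def
proof (intro conjI ballI)
  show "B \<subseteq> carrier E" using B by (simp add: L0_balanced_def)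
next
  fix x assume x: "x \<in> carrier E"
  then obtain g where g [measurable]: "g \<in> borel_measurable M" and pos: "AE w in M. 0 < g w"
    and gx: "ae_class M g \<odot>\<^bsub>E\<^esub> x \<in> B" using abs by blast
  have "\<eta> \<odot>\<^bsub>E\<^esub> x \<in> B" if \<eta>: "\<eta> \<in> L0 M" "ae_le M (L0_abs M \<eta>) (ae_class M g)" for \<eta>
  proof -
    obtain h where h [measurable]: "h \<in> borel_measurable M" and \<eta>h: "\<eta> = ae_class M h"
      using \<eta>(1) by (rule L0_cases)
    have hg: "AE w in M. \<bar>h w\<bar> \<le> g w"
      using \<eta>(2) by (simp add: \<eta>h L0_abs_class ae_le_class_iff)
    have "AE w in M. \<bar>h w / g w\<bar> \<le> 1"
      using hg pos by eventually_elim (simp add: abs_divide)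
    then have "ae_class M (\<lambda>w. h w / g w) \<odot>\<^bsub>E\<^esub> (ae_class M g \<odot>\<^bsub>E\<^esub> x) \<in> B"
      using B gx by (simp add: L0_balanced_iff)
    also have "ae_class M (\<lambda>w. h w / g w) \<odot>\<^bsub>E\<^esub> (ae_class M g \<odot>\<^bsub>E\<^esub> x) =
        ae_class M (\<lambda>w. h w / g w * g w) \<odot>\<^bsub>E\<^esub> x"
      using x by (simp add: smult_smult_class)
    also have "ae_class M (\<lambda>w. h w / g w * g w) = \<eta>"
    proof -
      \<comment> \<open>Cancellation may fail where \<open>g\<close> vanishes, but that is a null
        set and the classes agree.\<close>
      have "AE w in M. h w / g w * g w = h w" using pos by eventually_elim simp
      then show ?thesis unfolding \<eta>h by (subst ae_class_eq_iff) auto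
    qed
    finally show ?thesis .
  qed
  then show "\<exists>\<xi>\<in>L0_pplus M. \<forall>\<eta>\<in>L0 M. ae_le M (L0_abs M \<eta>) \<xi> \<longrightarrow> \<eta> \<odot>\<^bsub>E\<^esub> x \<in> B"
    using g pos by (intro bexI[of _ "ae_class M g"]) (auto simp: L0_pplus_class_iff)
qed

text \<open>Concatenation in \<open>E\<close> yields a candidate \<open>y\<close>. By distributivity
  \<open>a + y\<close> and \<open>a - y\<close> have the same pieces as the points
  \<open>a + x n\<close> and \<open>a - x n\<close> of \<open>C\<close>.\<close>

lemma countable_concatenation_symmetrization:
  assumes E: "countable_concatenation M E (carrier E)" and C: "countable_concatenation M E C"
    and CE: "C \<subseteq> carrier E" and a: "a \<in> carrier E"
  shows "countable_concatenation M E (symmetrization E a C)"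
  unfolding countable_concatenation_def
proof (intro allI impI)
  fix x :: "nat \<Rightarrow> 'e" and A
  assume x: "range x \<subseteq> symmetrization E a C" and A: "countable_partition M A"
  have x': "x n \<in> carrier E" "a \<oplus>\<^bsub>E\<^esub> x n \<in> C" "a \<ominus>\<^bsub>E\<^esub> x n \<in> C" for n
    using x by (auto simp: symmetrization_def)
  have ind: "L0_ind M (A n) \<in> carrier (L0_ring M)" for n
    unfolding L0_ind_def using A by (intro class_closed) (auto simp: countable_partition_def)
  obtain y where y: "y \<in> carrier E" "\<And>n. L0_ind M (A n) \<odot>\<^bsub>E\<^esub> y = L0_ind M (A n) \<odot>\<^bsub>E\<^esub> x n"
    using E A x' unfolding countable_concatenation_def by (metis image_subset_iff)
  \<comment> \<open>Regularity makes gluing unique: \<open>z\<close> must be the concatenation of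
    the \<open>u n\<close> that \<open>C\<close> contains.\<close>
  have mem: "z \<in> C" if z: "z \<in> carrier E" and u: "\<And>n. u n \<in> C"
    and zu: "\<And>n. L0_ind M (A n) \<odot>\<^bsub>E\<^esub> z = L0_ind M (A n) \<odot>\<^bsub>E\<^esub> u n" for z u
  proof -
    obtain v where v: "v \<in> C" "\<And>n. L0_ind M (A n) \<odot>\<^bsub>E\<^esub> v = L0_ind M (A n) \<odot>\<^bsub>E\<^esub> u n"
      using C A u unfolding countable_concatenation_def by (metis image_subset_iff)
    have "v = z" by (rule regular[OF _ z A]) (use v CE zu in auto)
    with v show ?thesis by simp
  qed
  have "a \<oplus>\<^bsub>E\<^esub> y \<in> C"
    by (rule mem[of _ "\<lambda>n. a \<oplus>\<^bsub>E\<^esub> x n"]) (use x' y a ind in \<open>simp_all add: E.smult_r_distr\<close>)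
  moreover have "a \<ominus>\<^bsub>E\<^esub> y \<in> C"
    by (rule mem[of _ "\<lambda>n. a \<ominus>\<^bsub>E\<^esub> x n"])
      (use x' y a ind in \<open>simp_all add: a_minus_def E.smult_r_distr E.smult_r_minus\<close>)
  ultimately show "\<exists>y\<in>symmetrization E a C. \<forall>n. L0_ind M (A n) \<odot>\<^bsub>E\<^esub> y = L0_ind M (A n) \<odot>\<^bsub>E\<^esub> x n"
    using y by (intro bexI[of _ y]) (auto simp: symmetrization_def)
qed

end

section \<open>Continuity of translations and reflections\<close>

context locally_L0_convex_module
begin

lemma continuous_map_translation:
  assumes "a \<in> carrier E"
  shows "continuous_map T T (\<lambda>x. a \<oplus>\<^bsub>E\<^esub> x)"
proof -
  have "continuous_map T (prod_topology T T) (\<lambda>x. (a, x))"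
    using assms by (simp add: continuous_map_pairedI topspace_eq)
  from continuous_map_compose[OF this continuous_add] show ?thesis by (simp add: o_def)
qed

text \<open>Negation is multiplication by the fixed scalar -1, hence a section of the jointly
  continuous scalar multiplication.\<close>

lemma continuous_map_uminus: "continuous_map T T (\<lambda>x. \<ominus>\<^bsub>E\<^esub> x)"
proof -
  have "continuous_map T (prod_topology (L0_topology M) T) (\<lambda>x. (ae_class M (\<lambda>_. - 1), x))"
    by (simp add: continuous_map_pairedI topspace_L0_topology ae_class_in_L0)
  from continuous_map_compose[OF this continuous_smult]
  have "continuous_map T T (\<lambda>x. ae_class M (\<lambda>_. - 1) \<odot>\<^bsub>E\<^esub> x)" by (simp add: o_def)
  then show ?thesis
    by (rule continuous_map_eq) (simp add: topspace_eq minus_eq_smult_class)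
qed

lemma closedin_symmetrization:
  assumes C: "closedin T C" and a: "a \<in> carrier E"
  shows "closedin T (symmetrization E a C)"
proof -
  have "continuous_map T T (\<lambda>x. a \<ominus>\<^bsub>E\<^esub> x)"
    using continuous_map_compose[OF continuous_map_uminus continuous_map_translation[OF a]]
    by (simp add: o_def a_minus_def)
  from closedin_Int[OF closedin_continuous_map_preimage[OF continuous_map_translation[OF a] C]
    closedin_continuous_map_preimage[OF this C]]
  show ?thesis
    by (rule back_subst[of "closedin T"]) (auto simp: symmetrization_def topspace_eq)
qed

end

section \<open>Convex functions\<close>

text \<open>The bound is a function and not a class, so that estimates can be made point by point;
  for measurable \<open>r\<close> these are the sets that lower semicontinuity declares
  closed.\<close>

definition L0_sublevel ::
  "'w measure \<Rightarrow> (('w \<Rightarrow> real) set, 'e) module \<Rightarrow> ('e \<Rightarrow> ('w \<Rightarrow> ereal) set) \<Rightarrow> ('w \<Rightarrow> real) \<Rightarrow> 'e set" where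
  "L0_sublevel M E f r = {x \<in> carrier E. AE w in M. ae_rep (f x) w \<le> ereal (r w)}"

lemma closedin_L0_sublevel:
  assumes "L0_lsc M E T f" "f \<in> carrier E \<rightarrow> L0bar M" "r \<in> borel_measurable M"
  shows "closedin T (L0_sublevel M E f r)"
proof -
  have "L0_sublevel M E f r = {x \<in> carrier E. ae_le M (f x) (to_L0bar M (ae_class M r))}"
    unfolding L0_sublevel_def
    by (intro Collect_cong conj_cong refl ae_le_to_L0bar_iff[symmetric] assms(3) funcset_mem[OF assms(2)])
  then show ?thesis using assms by (simp add: L0_lsc_def ae_class_in_L0)
qed

lemma of_L0bar_in_L0: "X \<in> L0bar M \<Longrightarrow> of_L0bar M X \<in> L0 M"
  unfolding of_L0bar_def
  by (rule ae_class_in_L0) (use ae_rep_L0bar in measurable)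

section \<open>Pointwise convexity, locality and sublevel sets\<close>

locale L0_convex_function = L0_module M E
  for M :: "'w measure" and E :: "(('w \<Rightarrow> real) set, 'e) module" +
  fixes f :: "'e \<Rightarrow> ('w \<Rightarrow> ereal) set"
  assumes maps_to_L0bar: "f \<in> carrier E \<rightarrow> L0bar M" and convex_fun: "L0_convex_fun M E f"
begin

lemma measurable_rep [measurable]: "x \<in> carrier E \<Longrightarrow> ae_rep (f x) \<in> borel_measurable M"
  using maps_to_L0bar by (auto intro: ae_rep_L0bar)

text \<open>Every operation on classes hides a chosen representative. Removing these choices one by
  one, each up to a null set, leaves the convexity inequality between actual functions, the form in
  which convexity is used from here on.\<close>

lemma convex_AE:
  assumes x: "x \<in> carrier E" "y \<in> carrier E" and g [measurable]: "g \<in> borel_measurable M"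
    and g01: "AE w in M. 0 \<le> g w" "AE w in M. g w \<le> 1"
  shows "AE w in M. ae_rep (f (ae_class M g \<odot>\<^bsub>E\<^esub> x \<oplus>\<^bsub>E\<^esub> ae_class M (\<lambda>w. 1 - g w) \<odot>\<^bsub>E\<^esub> y)) w
    \<le> ereal (g w) * ae_rep (f x) w + ereal (1 - g w) * ae_rep (f y) w"
proof -
  let ?X = "ae_mult M (to_L0bar M (ae_class M g)) (f x)"
  let ?Y = "ae_mult M (to_L0bar M (ae_class M (\<lambda>w. 1 - g w))) (f y)"
  have ereal_class: "AE w in M. ae_rep (to_L0bar M (ae_class M h)) w = ereal (h w)"
    and ereal_meas: "ae_rep (to_L0bar M (ae_class M h)) \<in> borel_measurable M"
    if h [measurable]: "h \<in> borel_measurable M" for h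
  proof -
    have [measurable]: "ae_rep (ae_class M h) \<in> borel_measurable M"
      by (intro ae_rep_L0(1) ae_class_in_L0 h)
    have "AE w in M. ae_rep (to_L0bar M (ae_class M h)) w = ereal (ae_rep (ae_class M h) w)"
      unfolding to_L0bar_def by (rule AE_ae_rep_class) simp
    with AE_ae_rep_class[OF h] show "AE w in M. ae_rep (to_L0bar M (ae_class M h)) w = ereal (h w)"
      by eventually_elim simp
    show "ae_rep (to_L0bar M (ae_class M h)) \<in> borel_measurable M"
      unfolding to_L0bar_def by (intro ae_rep_L0bar(1) ae_class_in_L0bar) simp
  qed
  have mult: "AE w in M. ae_rep (ae_mult M (to_L0bar M (ae_class M h)) (f z)) w = ereal (h w) * ae_rep (f z) w"
    and mult_meas: "ae_rep (ae_mult M (to_L0bar M (ae_class M h)) (f z)) \<in> borel_measurable M"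
    if h: "h \<in> borel_measurable M" and z: "z \<in> carrier E" for h z
  proof -
    note [measurable] = ereal_meas[OF h] measurable_rep[OF z]
    have m: "(\<lambda>w. ae_rep (to_L0bar M (ae_class M h)) w * ae_rep (f z) w) \<in> borel_measurable M"
      by measurable
    show "AE w in M. ae_rep (ae_mult M (to_L0bar M (ae_class M h)) (f z)) w = ereal (h w) * ae_rep (f z) w"
      unfolding ae_mult_def using AE_ae_rep_class[OF m] ereal_class[OF h] by eventually_elim simp
    show "ae_rep (ae_mult M (to_L0bar M (ae_class M h)) (f z)) \<in> borel_measurable M"
      unfolding ae_mult_def by (intro ae_rep_L0bar(1) ae_class_in_L0bar m)
  qed
  note [measurable] = mult_meas[OF g x(1)]
  have g': "(\<lambda>w. 1 - g w) \<in> borel_measurable M" by simp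
  note [measurable] = mult_meas[OF g' x(2)]
  have "AE w in M. ae_rep (ae_add M ?X ?Y) w = ae_rep ?X w + ae_rep ?Y w"
    unfolding ae_add_def by (rule AE_ae_rep_class) measurable
  moreover have "ae_le M (f (ae_class M g \<odot>\<^bsub>E\<^esub> x \<oplus>\<^bsub>E\<^esub> ae_class M (\<lambda>w. 1 - g w) \<odot>\<^bsub>E\<^esub> y)) (ae_add M ?X ?Y)"
    using convex_fun[unfolded L0_convex_fun_def, rule_format, OF x, of "ae_class M g"] g01
    by (simp add: L0_plus_class_iff ae_le_class_iff L0_ring_simps(4) L0_ring_minus_class)
  ultimately show ?thesis
    using mult[OF g x(1)] mult[OF g' x(2)] unfolding ae_le_def
    by eventually_elim simp
qed

lemma convex_sublevel: "L0_convex M E (L0_sublevel M E f r)"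
  unfolding L0_convex_iff
proof (intro conjI ballI impI)
  show "L0_sublevel M E f r \<subseteq> carrier E" by (auto simp: L0_sublevel_def)
next
  fix x y and g :: "_ \<Rightarrow> real"
  assume x: "x \<in> L0_sublevel M E f r" and y: "y \<in> L0_sublevel M E f r"
    and g: "g \<in> borel_measurable M" "AE w in M. 0 \<le> g w" "AE w in M. g w \<le> 1"
  have E: "x \<in> carrier E" "y \<in> carrier E" and le: "AE w in M. ae_rep (f x) w \<le> ereal (r w)"
    "AE w in M. ae_rep (f y) w \<le> ereal (r w)" using x y by (auto simp: L0_sublevel_def)
  have "AE w in M. ae_rep (f (ae_class M g \<odot>\<^bsub>E\<^esub> x \<oplus>\<^bsub>E\<^esub> ae_class M (\<lambda>w. 1 - g w) \<odot>\<^bsub>E\<^esub> y)) w \<le> ereal (r w)"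
    using convex_AE[OF E g] le g(2,3)
  proof eventually_elim
    case (elim w)
    note elim(1)
    also have "ereal (g w) * ae_rep (f x) w + ereal (1 - g w) * ae_rep (f y) w
        \<le> ereal (g w) * ereal (r w) + ereal (1 - g w) * ereal (r w)"
      using elim by (intro add_mono ereal_mult_left_mono) auto
    also have "\<dots> = ereal (r w)" by (simp add: algebra_simps)
    finally show ?case .
  qed
  then show "ae_class M g \<odot>\<^bsub>E\<^esub> x \<oplus>\<^bsub>E\<^esub> ae_class M (\<lambda>w. 1 - g w) \<odot>\<^bsub>E\<^esub> y \<in> L0_sublevel M E f r"
    using E g by (auto simp: L0_sublevel_def)
qed

text \<open>With the indicator of \<open>A\<close> as weight, \<open>x\<close> is also the convex
  combination of \<open>y\<close> and \<open>x\<close>. On \<open>A\<close> the convexity inequality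
  has coefficient 1 at \<open>f y\<close> and 0 at \<open>f x\<close>, and
  \<open>0 * \<infinity> = 0\<close> removes the latter even where it is infinite.\<close>

lemma local_AE:
  assumes x: "x \<in> carrier E" "y \<in> carrier E" and A [measurable]: "A \<in> sets M"
    and eq: "L0_ind M A \<odot>\<^bsub>E\<^esub> x = L0_ind M A \<odot>\<^bsub>E\<^esub> y"
  shows "AE w in M. w \<in> A \<longrightarrow> ae_rep (f x) w \<le> ae_rep (f y) w"
proof -
  let ?g = "indicator A :: 'w \<Rightarrow> real"
  have "x = ae_class M ?g \<odot>\<^bsub>E\<^esub> x \<oplus>\<^bsub>E\<^esub> ae_class M (\<lambda>w. 1 - ?g w) \<odot>\<^bsub>E\<^esub> x"
    using x by (simp add: smult_add_class smult_one_class)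
  also have "\<dots> = ae_class M ?g \<odot>\<^bsub>E\<^esub> y \<oplus>\<^bsub>E\<^esub> ae_class M (\<lambda>w. 1 - ?g w) \<odot>\<^bsub>E\<^esub> x"
    using eq by (simp add: L0_ind_def)
  finally have "AE w in M. ae_rep (f x) w \<le> ereal (?g w) * ae_rep (f y) w + ereal (1 - ?g w) * ae_rep (f x) w"
    using convex_AE[OF x(2,1), of ?g] by simp
  then show ?thesis by eventually_elim (auto simp flip: zero_ereal_def one_ereal_def)
qed

text \<open>Locality bounds \<open>f y\<close> by \<open>f (x n)\<close>, hence by \<open>r\<close>,
  on each piece \<open>A n\<close>; countably many exceptional null sets are still null, and the
  pieces cover the space.\<close>

lemma countable_concatenation_sublevel:
  assumes E: "countable_concatenation M E (carrier E)"
  shows "countable_concatenation M E (L0_sublevel M E f r)"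
  unfolding countable_concatenation_def
proof (intro allI impI)
  fix x :: "nat \<Rightarrow> 'e" and A
  assume x: "range x \<subseteq> L0_sublevel M E f r" and A: "countable_partition M A"
  have x': "x n \<in> carrier E" "AE w in M. ae_rep (f (x n)) w \<le> ereal (r w)" for n
    using x by (auto simp: L0_sublevel_def)
  obtain y where y: "y \<in> carrier E" "\<And>n. L0_ind M (A n) \<odot>\<^bsub>E\<^esub> y = L0_ind M (A n) \<odot>\<^bsub>E\<^esub> x n"
    using E A x' unfolding countable_concatenation_def by (metis image_subset_iff)
  have "AE w in M. w \<in> A n \<longrightarrow> ae_rep (f y) w \<le> ereal (r w)" for n
  proof -
    have "A n \<in> sets M" using A by (auto simp: countable_partition_def)
    from local_AE[OF y(1) x'(1) this y(2)] x'(2)[of n] show ?thesis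
      by eventually_elim auto
  qed
  then have "AE w in M. \<forall>n. w \<in> A n \<longrightarrow> ae_rep (f y) w \<le> ereal (r w)"
    unfolding AE_all_countable by blast
  then have "AE w in M. ae_rep (f y) w \<le> ereal (r w)"
    using AE_space
  proof eventually_elim
    case (elim w)
    then have "w \<in> (\<Union>n. A n)" using A by (simp add: countable_partition_def)
    with elim show ?case by blast
  qed
  with y show "\<exists>y\<in>L0_sublevel M E f r. \<forall>n. L0_ind M (A n) \<odot>\<^bsub>E\<^esub> y = L0_ind M (A n) \<odot>\<^bsub>E\<^esub> x n"
    by (intro bexI[of _ y]) (auto simp: L0_sublevel_def)
qed

section \<open>Estimates around a point of the domain\<close>

lemma L0_dom_finite:
  assumes "x \<in> L0_dom M E f"
  shows "AE w in M. ae_rep (f x) w = ereal (real_of_ereal (ae_rep (f x) w))"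
proof -
  have "AE w in M. \<bar>ae_rep (f x) w\<bar> < \<infinity>" using assms by (simp add: L0_dom_def)
  then show ?thesis by eventually_elim (auto simp: ereal_real)
qed

text \<open>Convexity along the segments from \<open>a\<close> to \<open>a \<plusminus> x\<close> keeps \<open>f\<close> below \<open>f(a) + e\<close>
  after scaling \<open>x\<close> by \<open>e / (1 + |f(a + x) - f(a)| + |f(a - x) - f(a)|)\<close>, cut off at \<open>1\<close>.\<close>
lemma scaled_in_symmetrization:
  assumes x: "x \<in> carrier E" and a: "a \<in> L0_dom M E f"
    and dom: "a \<oplus>\<^bsub>E\<^esub> x \<in> L0_dom M E f" "a \<ominus>\<^bsub>E\<^esub> x \<in> L0_dom M E f"
    and e [measurable]: "e \<in> borel_measurable M" and e_pos: "AE w in M. 0 < e w"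
  shows "\<exists>t\<in>borel_measurable M. (AE w in M. 0 < t w) \<and>
    ae_class M t \<odot>\<^bsub>E\<^esub> x \<in> symmetrization E a (L0_sublevel M E f (\<lambda>w. real_of_ereal (ae_rep (f a) w) + e w))"
proof -
  define F where "F z w = real_of_ereal (ae_rep (f z) w)" for z w
  have aE: "a \<in> carrier E" using a by (simp add: L0_dom_def)
  have [measurable]: "F z \<in> borel_measurable M" if "z \<in> carrier E" for z
    unfolding F_def using that by measurable
  have [measurable]: "F a \<in> borel_measurable M" "F (a \<oplus>\<^bsub>E\<^esub> x) \<in> borel_measurable M"
    "F (a \<ominus>\<^bsub>E\<^esub> x) \<in> borel_measurable M" using aE x by simp_all
  \<comment> \<open>The summand 1 makes \<open>q\<close> positive everywhere; including both
    increments lets the same \<open>t\<close> serve \<open>x\<close> and its negative.\<close>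
  define q where "q w = 1 + \<bar>F (a \<oplus>\<^bsub>E\<^esub> x) w - F a w\<bar> + \<bar>F (a \<ominus>\<^bsub>E\<^esub> x) w - F a w\<bar>" for w
  define t where "t w = min 1 (e w / q w)" for w
  have t [measurable]: "t \<in> borel_measurable M" unfolding t_def q_def by measurable
  have q: "q w > 0" for w unfolding q_def by simp
  have t_pos: "AE w in M. 0 < t w" using e_pos by eventually_elim (simp add: t_def q)
  then have t0: "AE w in M. 0 \<le> t w" by eventually_elim simp
  have t1: "AE w in M. t w \<le> 1" by (simp add: t_def)
  have sub: "a \<oplus>\<^bsub>E\<^esub> ae_class M t \<odot>\<^bsub>E\<^esub> y \<in> L0_sublevel M E f (\<lambda>w. F a w + e w)"
    if y: "y \<in> carrier E" and ydom: "a \<oplus>\<^bsub>E\<^esub> y \<in> L0_dom M E f"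
      and yq: "\<And>w. \<bar>F (a \<oplus>\<^bsub>E\<^esub> y) w - F a w\<bar> \<le> q w" for y
  proof -
    have "a \<oplus>\<^bsub>E\<^esub> ae_class M t \<odot>\<^bsub>E\<^esub> y = a \<oplus>\<^bsub>E\<^esub> (ae_class M t \<odot>\<^bsub>E\<^esub> y \<oplus>\<^bsub>E\<^esub> ae_class M (\<lambda>w. 1 - t w) \<odot>\<^bsub>E\<^esub> \<zero>\<^bsub>E\<^esub>)"
      using y by (simp add: E.smult_r_null)
    also have "\<dots> = ae_class M t \<odot>\<^bsub>E\<^esub> (a \<oplus>\<^bsub>E\<^esub> y) \<oplus>\<^bsub>E\<^esub> ae_class M (\<lambda>w. 1 - t w) \<odot>\<^bsub>E\<^esub> a"
      using y aE by (subst add_convex_combination) simp_all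
    finally have eq: "a \<oplus>\<^bsub>E\<^esub> ae_class M t \<odot>\<^bsub>E\<^esub> y = \<dots>" .
    have ayE: "a \<oplus>\<^bsub>E\<^esub> y \<in> carrier E" using aE y by simp
    have "AE w in M. ae_rep (f (a \<oplus>\<^bsub>E\<^esub> ae_class M t \<odot>\<^bsub>E\<^esub> y)) w \<le> ereal (F a w + e w)"
      using convex_AE[OF ayE aE t t0 t1, folded eq] L0_dom_finite[OF a] L0_dom_finite[OF ydom] e_pos t_pos
    proof eventually_elim
      case (elim w)
      \<comment> \<open>The convex bound equals \<open>F a + t (F (a + y) - F a)\<close>, so it
        remains to see that the increment is at most \<open>t q \<le> e\<close>.\<close>
      have "t w * (F (a \<oplus>\<^bsub>E\<^esub> y) w - F a w) \<le> t w * q w"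
        using yq[of w] elim by (intro mult_left_mono) auto
      also have "t w * q w \<le> e w / q w * q w"
        using q[of w] by (intro mult_right_mono) (auto simp: t_def)
      also have "\<dots> = e w" using q[of w] by simp
      finally have "t w * F (a \<oplus>\<^bsub>E\<^esub> y) w + (1 - t w) * F a w \<le> F a w + e w"
        by (simp add: algebra_simps)
      moreover have "ereal (t w) * ae_rep (f (a \<oplus>\<^bsub>E\<^esub> y)) w + ereal (1 - t w) * ae_rep (f a) w =
          ereal (t w * F (a \<oplus>\<^bsub>E\<^esub> y) w + (1 - t w) * F a w)"
        unfolding F_def by (subst elim(2), subst elim(3)) simp
      ultimately show ?case using elim(1) by (metis ereal_less_eq(3) order_trans)
    qed
    then show ?thesis using aE y by (simp add: L0_sublevel_def)
  qed
  have "a \<oplus>\<^bsub>E\<^esub> ae_class M t \<odot>\<^bsub>E\<^esub> x \<in> L0_sublevel M E f (\<lambda>w. F a w + e w)"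
    using x dom by (intro sub) (auto simp: q_def)
  moreover have "a \<oplus>\<^bsub>E\<^esub> ae_class M t \<odot>\<^bsub>E\<^esub> (\<ominus>\<^bsub>E\<^esub> x) \<in> L0_sublevel M E f (\<lambda>w. F a w + e w)"
    using x dom by (intro sub) (auto simp: q_def a_minus_def)
  ultimately show ?thesis
    using x t t_pos by (intro bexI[of _ t]) (simp_all add: symmetrization_def a_minus_def E.smult_r_minus F_def)
qed

text \<open>Let \<open>y = 2 a - x\<close>, the reflection of \<open>x\<close> in \<open>a\<close>.
  Membership bounds both \<open>f x\<close> and \<open>f y\<close> by \<open>f a + e\<close>, and
  \<open>2 f a \<le> f x + f y\<close> turns the bound on \<open>f y\<close> into the lower bound
  \<open>f a - e\<close> for \<open>f x\<close>.\<close>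

lemma symmetrization_sublevel_bound:
  assumes a: "a \<in> L0_dom M E f" and x: "x \<in> L0_dom M E f"
    and mem: "x \<ominus>\<^bsub>E\<^esub> a \<in> symmetrization E a (L0_sublevel M E f (\<lambda>w. real_of_ereal (ae_rep (f a) w) + e w))"
  shows "AE w in M. \<bar>real_of_ereal (ae_rep (f x) w) - real_of_ereal (ae_rep (f a) w)\<bar> \<le> e w"
proof -
  let ?y = "a \<ominus>\<^bsub>E\<^esub> (x \<ominus>\<^bsub>E\<^esub> a)" and ?h = "\<lambda>_. 1 / 2 :: real"
  have aE: "a \<in> carrier E" and xE: "x \<in> carrier E" using a x by (simp_all add: L0_dom_def)
  have x_eq: "a \<oplus>\<^bsub>E\<^esub> (x \<ominus>\<^bsub>E\<^esub> a) = x"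
    using aE xE by (simp add: a_minus_def E.M.add.m_lcomm[of a x] E.M.r_neg)
  have y_eq: "x \<oplus>\<^bsub>E\<^esub> ?y = a \<oplus>\<^bsub>E\<^esub> a"
    using aE xE by (simp add: a_minus_def E.minus_add E.add.m_ac E.M.r_neg E.M.r_neg1 E.M.r_neg2)
  have yE: "?y \<in> carrier E" using aE xE by simp
  have "ae_class M ?h \<odot>\<^bsub>E\<^esub> x \<oplus>\<^bsub>E\<^esub> ae_class M (\<lambda>w. 1 - ?h w) \<odot>\<^bsub>E\<^esub> ?y = ae_class M ?h \<odot>\<^bsub>E\<^esub> (x \<oplus>\<^bsub>E\<^esub> ?y)"
    using xE yE by (simp add: E.smult_r_distr)
  also have "\<dots> = a"
    unfolding y_eq using aE by (simp add: E.smult_r_distr smult_add_class smult_one_class)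
  finally have mid: "ae_class M ?h \<odot>\<^bsub>E\<^esub> x \<oplus>\<^bsub>E\<^esub> ae_class M (\<lambda>w. 1 - ?h w) \<odot>\<^bsub>E\<^esub> ?y = a" .
  have conv: "AE w in M. ae_rep (f a) w \<le> ereal (1/2) * ae_rep (f x) w + ereal (1/2) * ae_rep (f ?y) w"
    using convex_AE[OF xE yE, of ?h] unfolding mid by simp
  have "AE w in M. ae_rep (f x) w \<le> ereal (real_of_ereal (ae_rep (f a) w) + e w)"
    and "AE w in M. ae_rep (f ?y) w \<le> ereal (real_of_ereal (ae_rep (f a) w) + e w)"
    using mem x_eq by (auto simp: symmetrization_def L0_sublevel_def)
  with conv L0_dom_finite[OF a] L0_dom_finite[OF x] show ?thesis
  proof eventually_elim
    case (elim w)
    define r s where "r = real_of_ereal (ae_rep (f a) w)" and "s = real_of_ereal (ae_rep (f x) w)"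
    have rs: "ae_rep (f a) w = ereal r" "ae_rep (f x) w = ereal s"
      unfolding r_def s_def using elim by simp_all
    \<comment> \<open>The reflected point is not assumed to lie in the domain, so its value stays
      extended real until it is replaced by its finite upper bound.\<close>
    have le: "ae_rep (f ?y) w \<le> ereal (r + e w)" "s \<le> r + e w" using elim rs by simp_all
    have "ereal r \<le> ereal (1/2) * ereal s + ereal (1/2) * ae_rep (f ?y) w" using elim(1) rs by simp
    also have "\<dots> \<le> ereal (1/2) * ereal s + ereal (1/2) * ereal (r + e w)"
      using le by (intro add_left_mono ereal_mult_left_mono) auto
    finally have "r \<le> 1/2 * s + 1/2 * (r + e w)" by simp
    with le(2) show ?case unfolding r_def[symmetric] s_def[symmetric] by argo
  qed
qed

end

section \<open>Continuity on the interior of the domain\<close>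

theorem theorem3p44:
  fixes M :: "'w measure"
    and E :: "(('w \<Rightarrow> real) set, 'e) module"
    and T :: "'e topology"
    and f :: "'e \<Rightarrow> ('w \<Rightarrow> ereal) set"
  assumes "L0_pre_barreled_module M E T"
    and "countable_concatenation M E (carrier E)"
    and "f \<in> carrier E \<rightarrow> L0bar M"
    and "L0_proper M E f"
    and "L0_lsc M E T f"
    and "L0_convex_fun M E f"
  shows "continuous_map (subtopology T (T interior_of L0_dom M E f)) (L0_topology M)
           (\<lambda>x. of_L0bar M (f x))"
proof -
  interpret L0_pre_barreled_module M E T by (rule assms)
  interpret L0_convex_function M E f using assms by unfold_locales auto
  let ?I = "T interior_of L0_dom M E f"
  have I_dom: "?I \<subseteq> L0_dom M E f" and I_open: "openin T ?I" by (auto simp: interior_of_subset)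
  have dom_E: "L0_dom M E f \<subseteq> carrier E" by (auto simp: L0_dom_def)
  \<comment> \<open>Since \<open>?I\<close> is open, continuity on it amounts to openness in
    \<open>T\<close> of each preimage within \<open>?I\<close>, checked at every point
    \<open>a\<close>.\<close>
  have "\<exists>U. openin T U \<and> a \<in> U \<and> U \<subseteq> {x \<in> ?I. of_L0bar M (f x) \<in> G}"
    if G: "openin (L0_topology M) G" and a: "a \<in> ?I" and aG: "of_L0bar M (f a) \<in> G" for G a
  proof -
    have a_dom: "a \<in> L0_dom M E f" and aE: "a \<in> carrier E" using a I_dom dom_E by auto
    let ?F = "\<lambda>x w. real_of_ereal (ae_rep (f x) w)"
    have F: "?F x \<in> borel_measurable M" if "x \<in> carrier E" for x using that by measurable
    from G aG obtain \<epsilon> where "\<epsilon> \<in> L0_pplus M"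
      and ball: "{Y \<in> L0 M. ae_le M (L0_abs M (Y \<ominus>\<^bsub>L0_ring M\<^esub> of_L0bar M (f a))) \<epsilon>} \<subseteq> G"
      unfolding openin_L0_topology by blast
    then obtain e where e [measurable]: "e \<in> borel_measurable M" and e_pos: "AE w in M. 0 < e w"
      and \<epsilon>: "\<epsilon> = ae_class M e" by (elim L0_pplus_cases)
    define C where "C = L0_sublevel M E f (\<lambda>w. ?F a w + e w)"
    define B where "B = symmetrization E a C"
    have C: "L0_convex M E C" "countable_concatenation M E C" "closedin T C" "C \<subseteq> carrier E"
    proof -
      show "closedin T C"
        unfolding C_def using F[OF aE] by (intro closedin_L0_sublevel[OF assms(5,3)]) simp
      then show "C \<subseteq> carrier E" using closedin_subset[of T C] by (simp add: topspace_eq)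
    qed (simp_all add: C_def convex_sublevel countable_concatenation_sublevel[OF assms(2)])
    have bal: "L0_balanced M E B" unfolding B_def by (rule balanced_symmetrization[OF C(1) aE])
    \<comment> \<open>Translating the interior by \<open>- a\<close> gives a neighbourhood of zero;
      an absorbent set \<open>U\<close> inside it supplies, in every direction, multiples that keep
      \<open>a\<close> in the domain when added.\<close>
    have "openin T {x \<in> topspace T. a \<oplus>\<^bsub>E\<^esub> x \<in> ?I}"
      by (rule openin_continuous_map_preimage[OF continuous_map_translation[OF aE] I_open])
    moreover have "\<zero>\<^bsub>E\<^esub> \<in> {x \<in> topspace T. a \<oplus>\<^bsub>E\<^esub> x \<in> ?I}" using a aE by (simp add: topspace_eq)
    ultimately obtain U where U: "L0_absorbent M E U" "U \<subseteq> {x \<in> topspace T. a \<oplus>\<^bsub>E\<^esub> x \<in> ?I}"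
      using local_base unfolding neighbourhood_base_at_def by (metis (no_types, lifting))
    \<comment> \<open>Two scalings are combined: \<open>g\<close> brings
      \<open>a \<plusminus> g x\<close> into the domain, then \<open>t\<close> lowers the values at
      \<open>a \<plusminus> t g x\<close> below \<open>f a + e\<close>. Their product is the
      required scalar.\<close>
    have "L0_absorbent M E B"
    proof (rule balanced_absorbentI[OF bal])
      fix x assume x: "x \<in> carrier E"
      then obtain \<xi> where "\<xi> \<in> L0_pplus M"
        and \<xi>: "\<forall>\<eta>\<in>L0 M. ae_le M (L0_abs M \<eta>) \<xi> \<longrightarrow> \<eta> \<odot>\<^bsub>E\<^esub> x \<in> U"
        using U(1) unfolding L0_absorbent_def by blast
      then obtain g where g [measurable]: "g \<in> borel_measurable M" and g_pos: "AE w in M. 0 < g w"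
        and \<xi>g: "\<xi> = ae_class M g" by (elim L0_pplus_cases)
      \<comment> \<open>The absorption radius and its negative are themselves admissible
        scalars.\<close>
      have "AE w in M. \<bar>g w\<bar> \<le> g w" using g_pos by eventually_elim simp
      then have "ae_class M g \<odot>\<^bsub>E\<^esub> x \<in> U" "ae_class M (\<lambda>w. - g w) \<odot>\<^bsub>E\<^esub> x \<in> U"
        using \<xi> by (simp_all add: \<xi>g ae_class_in_L0 L0_abs_class ae_le_class_iff)
      then have "a \<oplus>\<^bsub>E\<^esub> ae_class M g \<odot>\<^bsub>E\<^esub> x \<in> L0_dom M E f" "a \<ominus>\<^bsub>E\<^esub> ae_class M g \<odot>\<^bsub>E\<^esub> x \<in> L0_dom M E f"
        using U(2) I_dom x by (auto simp: smult_uminus_class a_minus_def)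
      from scaled_in_symmetrization[OF _ a_dom this e e_pos] x
      obtain t where t [measurable]: "t \<in> borel_measurable M" and t_pos: "AE w in M. 0 < t w"
        and tx: "ae_class M t \<odot>\<^bsub>E\<^esub> (ae_class M g \<odot>\<^bsub>E\<^esub> x) \<in> B"
        unfolding B_def C_def by auto
      show "\<exists>g\<in>borel_measurable M. (AE w in M. 0 < g w) \<and> ae_class M g \<odot>\<^bsub>E\<^esub> x \<in> B"
      proof (intro bexI conjI)
        show "AE w in M. 0 < t w * g w" using t_pos g_pos by eventually_elim simp
        show "ae_class M (\<lambda>w. t w * g w) \<odot>\<^bsub>E\<^esub> x \<in> B" using tx x by (simp add: smult_smult_class)
      qed simp
    qed
    then have "L0_barrel M E T B"
      unfolding L0_barrel_def using bal C aE
      by (auto simp: B_def intro: convex_symmetrization closedin_symmetrization)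
    moreover have "countable_concatenation M E B"
      unfolding B_def by (rule countable_concatenation_symmetrization[OF assms(2) C(2,4) aE])
    ultimately have zero: "\<zero>\<^bsub>E\<^esub> \<in> T interior_of B" by (rule pre_barreled)
    \<comment> \<open>This is \<open>a + Int B\<close> cut down to \<open>?I\<close>, where
      \<open>f\<close> is finite and \<open>of_L0bar\<close> does not fall back on its default value
      0.\<close>
    let ?U = "?I \<inter> {x \<in> topspace T. \<ominus>\<^bsub>E\<^esub> a \<oplus>\<^bsub>E\<^esub> x \<in> T interior_of B}"
    have "openin T ?U"
      using aE by (intro openin_Int I_open
          openin_continuous_map_preimage[OF continuous_map_translation]) auto
    moreover have "a \<in> ?U" using a aE zero by (simp add: topspace_eq E.M.l_neg)
    moreover have "of_L0bar M (f x) \<in> G" if "x \<in> ?U" for x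
    proof -
      have x_dom: "x \<in> L0_dom M E f" and xE: "x \<in> carrier E"
        using that I_dom dom_E by auto
      have "\<ominus>\<^bsub>E\<^esub> a \<oplus>\<^bsub>E\<^esub> x \<in> B" using that interior_of_subset[of T B] by blast
      then have "x \<ominus>\<^bsub>E\<^esub> a \<in> B" using aE xE by (simp add: a_minus_def E.add.m_comm)
      then have "AE w in M. \<bar>?F x w - ?F a w\<bar> \<le> e w"
        unfolding B_def C_def by (rule symmetrization_sublevel_bound[OF a_dom x_dom])
      then have "ae_le M (L0_abs M (of_L0bar M (f x) \<ominus>\<^bsub>L0_ring M\<^esub> of_L0bar M (f a))) \<epsilon>"
        using F[OF aE] F[OF xE]
        by (simp add: of_L0bar_def \<epsilon> L0_ring_minus_class L0_abs_class ae_le_class_iff)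
      with ball show ?thesis using xE assms(3) of_L0bar_in_L0[of "f x" M] by blast
    qed
    ultimately show ?thesis by blast
  qed
  then have "openin T {x \<in> ?I. of_L0bar M (f x) \<in> G}" if "openin (L0_topology M) G" for G
    using that by (subst openin_subopen) fastforce
  moreover have "topspace (subtopology T ?I) = ?I"
    using openin_subset[OF I_open] by (rule topspace_subtopology_subset)
  ultimately show ?thesis
    using assms(3) I_dom dom_E
    by (auto simp: continuous_map_def topspace_L0_topology openin_open_subtopology[OF I_open]
        intro!: of_L0bar_in_L0)
qed

end
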